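(* The polynomials $J_\lambda$ are linked to the polynomials $J_n^{(r)}$ by the following equations (whose coefficients are strictly positive): for all integers $n\ge r\ge1$, $$\frac{(n-1)!}{r!\,(n-r)!}\,q^{\binom r2}J_n^{(r)}=\sum_{|\lambda|=n,\;l(\lambda)=r}\frac{J_\lambda}{m(\lambda)!}\,q^{n(\lambda)},$$ and for all $n\ge2$, $$J_n=(n-1)\sum_{|\lambda|=n-1}\frac{J_\lambda}{m(\lambda)!}\,q^{n(\lambda)}.$$
   Context: Let $\Lambda$ be the algebra of symmetric functions in $x_1,x_2,\dots$ over $\mathbb{Q}(q)$, with monomial symmetric functions $m_\lambda$ and elementary symmetric functions $e_n$ ($e_0=1$). The specialization considered is the $\mathbb{Q}(q)$-algebra homomorphism $\Lambda\to\mathbb{Q}(q)$ determined by $e_n\mapsto q^{\binom n2}/n!$; symmetric functions are identified with their images. For a partition $\lambda=(\lambda_1\ge\dots\ge\lambda_k>0)$: $|\lambda|=\lambda_1+\dots+\lambda_k$, $l(\lambda)=k$, $n(\lambda)=\sum_{i\ge1}(i-1)\lambda_i$; if $r_i$ is the number of parts equal to $i$, then $m(\lambda)!=r_1!\,r_2!\cdots$. $J_\lambda\in\mathbb{Z}[q]$ is the polynomial defined, under this specialization, by $m_\lambda=(1-q)^{|\lambda|-l(\lambda)}\frac{q^{n(\lambda)}}{(|\lambda|-1)!\,m(\lambda)!}J_\lambda$. For $n\ge r\ge1$ let $p_n^{(r)}=\sum_{|\lambda|=n,\,l(\lambda)=r}m_\lambda$. The polynomial $J_n^{(r)}$ is defined,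 under this specialization, by $p_n^{(r)}=(1-q)^{n-r}\frac{q^{\binom r2}}{r!\,(n-r)!}J_n^{(r)}(q)$ (it is known to be a monic polynomial with positive integer coefficients, of degree $\binom{n-1}2-\binom{r-1}2$). Also $J_n=J_n^{(1)}$, which is known to be the inversion enumerator of labelled trees on $n$ vertices. It is known that for $n-1\ge r\ge1$, $J_n^{(r)}(q)=\sum_{j=1}^{n-r}[r]_q^j\,q^{\binom j2}\binom{n-r}{j}J_{n-r}^{(j)}(q)$, where $[r]_q=1+q+\dots+q^{r-1}$. *)

theory Defs
  imports
    "HOL-Library.Multiset"
    "HOL-Computational_Algebra.Polynomial"
    "HOL-Computational_Algebra.Fraction_Field"
begin

section \<open>Symmetric functions in countably many variables\<close>

text \<open>
  A monomial in the variables \<open>x\<^sub>0, x\<^sub>1, \<dots>\<close> is encoded as the multiset of the indices occurring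
  in it, so that multiplication of monomials is addition of multisets and the degree is the size.
  A symmetric function is a formal series of bounded degree, given by its coefficient function,
  that is invariant under all permutations of the variables.
\<close>

lemma finite_submultisets: "finite {A. A \<subseteq># (M :: 'b multiset)}"
proof (induction M)
  case empty
  show ?case by simp
next
  case (add x M)
  have "{A. A \<subseteq># add_mset x M} \<subseteq> {A. A \<subseteq># M} \<union> add_mset x ` {A. A \<subseteq># M}"
  proof
    fix A assume "A \<in> {A. A \<subseteq># add_mset x M}"
    hence A: "A \<subseteq># add_mset x M" by simp
    show "A \<in> {A. A \<subseteq># M} \<union> add_mset x ` {A. A \<subseteq># M}"
    proof (cases "x \<in># A")
      case True
      then obtain B where "A = add_mset x B" by (metis insert_DiffM)
      with A show ?thesis by auto
    next
      case False
      hence "count A x = 0" by (simp add: not_in_iff)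
      hence "A \<subseteq># M"
        using A by (metis False add_mset_remove_trivial diff_single_trivial subset_eq_diff_conv
            add_mset_add_single)
      thus ?thesis by simp
    qed
  qed
  thus ?case using add.IH by (meson finite_UnI finite_imageI finite_subset)
qed

definition symmetric_series :: "(nat multiset \<Rightarrow> 'a::comm_ring_1) \<Rightarrow> bool" where
  "symmetric_series f \<longleftrightarrow>
     (\<exists>d. \<forall>M. size M > d \<longrightarrow> f M = 0) \<and>
     (\<forall>\<pi> M. bij \<pi> \<longrightarrow> f (image_mset \<pi> M) = f M)"

lemma symmetric_seriesI:
  assumes "\<And>M. size M > d \<Longrightarrow> f M = 0"
    and "\<And>\<pi> M. bij \<pi> \<Longrightarrow> f (image_mset \<pi> M) = f M"
  shows "symmetric_series f"
  using assms unfolding symmetric_series_def by blast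

lemma count_image_mset_bij:
  assumes "bij \<pi>"
  shows "count (image_mset \<pi> M) (\<pi> x) = count M x"
  using bij_is_inj[OF assms] by (induction M) (auto simp: inj_eq)

definition series_times ::
  "(nat multiset \<Rightarrow> 'a::comm_ring_1) \<Rightarrow> (nat multiset \<Rightarrow> 'a) \<Rightarrow> nat multiset \<Rightarrow> 'a" where
  "series_times f g M = (\<Sum>A | A \<subseteq># M. f A * g (M - A))"

lemma series_times_perm:
  assumes f: "\<And>M. f (image_mset \<pi> M) = f M" and g: "\<And>M. g (image_mset \<pi> M) = g M"
    and \<pi>: "bij \<pi>"
  shows "series_times f g (image_mset \<pi> M) = series_times f g M"
  unfolding series_times_def
proof (rule sum.reindex_bij_witness[of _ "image_mset \<pi>" "image_mset (inv \<pi>)"])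
  have c1: "inv \<pi> \<circ> \<pi> = id" and c2: "\<pi> \<circ> inv \<pi> = id"
    using \<pi> by (auto simp: bij_def surj_iff)
  have i1: "image_mset (inv \<pi>) (image_mset \<pi> A) = A" for A
    by (simp only: multiset.map_comp c1 multiset.map_id)
  have i2: "image_mset \<pi> (image_mset (inv \<pi>) A) = A" for A
    by (simp only: multiset.map_comp c2 multiset.map_id)
  fix A
  show "image_mset (inv \<pi>) (image_mset \<pi> A) = A" by (rule i1)
  show "image_mset \<pi> (image_mset (inv \<pi>) A) = A" by (rule i2)
  show "image_mset \<pi> A \<in> {A. A \<subseteq># image_mset \<pi> M}" if "A \<in> {A. A \<subseteq># M}"
    using that by (simp add: image_mset_subseteq_mono)
  assume "A \<in> {A. A \<subseteq># image_mset \<pi> M}"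
  hence A: "A \<subseteq># image_mset \<pi> M" by simp
  show A': "image_mset (inv \<pi>) A \<in> {A. A \<subseteq># M}"
    using image_mset_subseteq_mono[OF A, of "inv \<pi>"] by (simp only: i1 mem_Collect_eq)
  have "f (image_mset (inv \<pi>) A) = f A"
    using f[of "image_mset (inv \<pi>) A"] by (simp only: i2)
  moreover have "g (M - image_mset (inv \<pi>) A) = g (image_mset \<pi> M - A)"
    using g[of "M - image_mset (inv \<pi>) A"] A' by (simp only: image_mset_Diff mem_Collect_eq i2)
  ultimately show "f (image_mset (inv \<pi>) A) * g (M - image_mset (inv \<pi>) A) = f A * g (image_mset \<pi> M - A)"
    by simp
qed

lemma series_times_bounded:
  assumes f: "\<forall>M. size M > d \<longrightarrow> f M = 0" and g: "\<forall>M. size M > e \<longrightarrow> g M = 0"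
    and M: "size M > d + e"
  shows "series_times f g M = 0"
  unfolding series_times_def
proof (rule sum.neutral, clarify)
  fix A assume A: "A \<subseteq># M"
  hence "size (M - A) = size M - size A" by (rule size_Diff_submset)
  with M have "size A > d \<or> size (M - A) > e" by linarith
  thus "f A * g (M - A) = 0" using f g by auto
qed

lemma series_times_commute: "series_times f g M = series_times g f M"
  unfolding series_times_def
  by (rule sum.reindex_bij_witness[of _ "\<lambda>A. M - A" "\<lambda>A. M - A"])
     (auto simp: subset_mset.diff_diff_right mult.commute)

lemma series_times_assoc:
  "series_times (series_times f g) h M = series_times f (series_times g h) M"
proof -
  have "series_times (series_times f g) h M =
      (\<Sum>(A, B)\<in>Sigma {A. A \<subseteq># M} (\<lambda>A. {B. B \<subseteq># A}). f B * g (A - B) * h (M - A))"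
    unfolding series_times_def
    by (subst sum.Sigma[symmetric]) (auto simp: finite_submultisets sum_distrib_right)
  also have "\<dots> = (\<Sum>(A, B)\<in>Sigma {A. A \<subseteq># M} (\<lambda>A. {B. B \<subseteq># M - A}). f A * g B * h (M - A - B))"
  proof (rule sum.reindex_bij_witness[of _ "\<lambda>(A, B). (A + B, A)" "\<lambda>(A, B). (B, A - B)"],
      goal_cases)
    case (1 a)
    thus ?case
      by (auto simp: multiset_eq_iff subseteq_mset_def)
  next
    case (2 a)
    obtain A B where a: "a = (A, B)" by force
    have "count A x \<le> count M x" "count B x \<le> count A x" for x
      using 2 by (auto simp: a subseteq_mset_def)
    hence "count B x \<le> count M x" "count A x - count B x \<le> count M x - count B x" for x
      by (meson le_trans diff_le_mono)+
    thus ?case by (auto simp: a subseteq_mset_def)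
  next
    case (3 b)
    thus ?case by auto
  next
    case (4 b)
    obtain A B where b: "b = (A, B)" by force
    have "count A x \<le> count M x" "count B x \<le> count M x - count A x" for x
      using 4 by (auto simp: b subseteq_mset_def)
    hence "count A x + count B x \<le> count M x" for x
      by (metis add.commute le_diff_conv2)
    thus ?case by (auto simp: b subseteq_mset_def)
  next
    case (5 a)
    obtain A B where a: "a = (A, B)" by force
    have "M - B - (A - B) = M - A"
      using 5 by (auto simp: a subset_mset.add_diff_inverse diff_diff_add_mset)
    thus ?case by (simp add: a)
  qed
  also have "\<dots> = series_times f (series_times g h) M"
    unfolding series_times_def
    by (subst sum.Sigma[symmetric])
       (auto simp: finite_submultisets sum_distrib_left mult.assoc)
  finally show ?thesis .
qed

typedef (overloaded) 'a symfun = "{f :: nat multiset \<Rightarrow> 'a::comm_ring_1. symmetric_series f}"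
  morphisms coeff_sym Abs_symfun
  by (rule exI[of _ "\<lambda>_. 0"]) (simp add: symmetric_series_def)

setup_lifting type_definition_symfun

instantiation symfun :: (comm_ring_1) comm_ring_1
begin

lift_definition zero_symfun :: "'a symfun" is "\<lambda>_. 0"
  by (simp add: symmetric_series_def)

lift_definition one_symfun :: "'a symfun" is "\<lambda>M. if M = {#} then 1 else 0"
  by (auto simp: symmetric_series_def)

lift_definition plus_symfun :: "'a symfun \<Rightarrow> 'a symfun \<Rightarrow> 'a symfun" is "\<lambda>f g M. f M + g M"
proof -
  fix f g :: "nat multiset \<Rightarrow> 'a"
  assume f: "symmetric_series f" and g: "symmetric_series g"
  obtain d e where "\<forall>M. size M > d \<longrightarrow> f M = 0" "\<forall>M. size M > e \<longrightarrow> g M = 0"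
    using f g by (auto simp: symmetric_series_def)
  thus "symmetric_series (\<lambda>M. f M + g M)"
    using f g by (intro symmetric_seriesI[of "max d e"]) (auto simp: symmetric_series_def)
qed

lift_definition uminus_symfun :: "'a symfun \<Rightarrow> 'a symfun" is "\<lambda>f M. - f M"
  by (auto simp: symmetric_series_def)

definition minus_symfun :: "'a symfun \<Rightarrow> 'a symfun \<Rightarrow> 'a symfun" where
  "minus_symfun f g = f + (- g)"

lift_definition times_symfun :: "'a symfun \<Rightarrow> 'a symfun \<Rightarrow> 'a symfun" is series_times
proof -
  fix f g :: "nat multiset \<Rightarrow> 'a"
  assume f: "symmetric_series f" and g: "symmetric_series g"
  obtain d e where "\<forall>M. size M > d \<longrightarrow> f M = 0" "\<forall>M. size M > e \<longrightarrow> g M = 0"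
    using f g by (auto simp: symmetric_series_def)
  hence "\<forall>M. size M > d + e \<longrightarrow> series_times f g M = 0"
    using series_times_bounded by blast
  moreover have "series_times f g (image_mset \<pi> M) = series_times f g M" if "bij \<pi>" for \<pi> M
    using f g that by (intro series_times_perm) (auto simp: symmetric_series_def)
  ultimately show "symmetric_series (series_times f g)"
    unfolding symmetric_series_def by blast
qed

instance
proof
  fix a b c :: "'a symfun"
  show "a * b * c = a * (b * c)" by transfer (rule ext, rule series_times_assoc)
  show "a * b = b * a" by transfer (rule ext, rule series_times_commute)
  show "1 * a = a"
  proof (transfer, rule ext)
    fix f :: "nat multiset \<Rightarrow> 'a" and M
    have "series_times (\<lambda>M. if M = {#} then 1 else 0) f M =
        (\<Sum>A | A \<subseteq># M. if A = {#} then f M else 0)"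
      unfolding series_times_def by (rule sum.cong) auto
    also have "\<dots> = f M" by (simp add: finite_submultisets)
    finally show "series_times (\<lambda>M. if M = {#} then 1 else 0) f M = f M" .
  qed
  show "(a + b) * c = a * c + b * c"
    by transfer (simp add: fun_eq_iff series_times_def distrib_right sum.distrib)
  show "a + b + c = a + (b + c)" by transfer (simp add: add.assoc)
  show "a + b = b + a" by transfer (simp add: add.commute)
  show "0 + a = a" by transfer simp
  show "- a + a = 0" by transfer simp
  show "a - b = a + - b" by (rule minus_symfun_def)
  show "(0 :: 'a symfun) \<noteq> 1" by transfer (auto simp: fun_eq_iff)
qed

end

lift_definition scale_sym :: "'a::comm_ring_1 \<Rightarrow> 'a symfun \<Rightarrow> 'a symfun" is "\<lambda>c f M. c * f M"
  unfolding symmetric_series_def by (metis mult_zero_right)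

definition algebra_hom :: "('a::comm_ring_1 symfun \<Rightarrow> 'a) \<Rightarrow> bool" where
  "algebra_hom \<phi> \<longleftrightarrow>
     \<phi> 1 = 1 \<and>
     (\<forall>f g. \<phi> (f + g) = \<phi> f + \<phi> g) \<and>
     (\<forall>f g. \<phi> (f * g) = \<phi> f * \<phi> g) \<and>
     (\<forall>c f. \<phi> (scale_sym c f) = c * \<phi> f)"

section \<open>Partitions\<close>

definition is_partition :: "nat list \<Rightarrow> bool" where
  "is_partition l \<longleftrightarrow> sorted_wrt (\<ge>) l \<and> (\<forall>x\<in>set l. x > 0)"

definition partitions :: "nat \<Rightarrow> nat list set" where
  "partitions n = {l. is_partition l \<and> sum_list l = n}"

definition partitions_len :: "nat \<Rightarrow> nat \<Rightarrow> nat list set" where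
  "partitions_len n r = {l \<in> partitions n. length l = r}"

text \<open>\<open>n(\<lambda>) = \<Sum>(i - 1) \<lambda>\<^sub>i\<close>; list indices start at 0.\<close>

definition n_stat :: "nat list \<Rightarrow> nat" where
  "n_stat l = (\<Sum>i<length l. i * l ! i)"

definition m_fact :: "nat list \<Rightarrow> nat" where
  "m_fact l = (\<Prod>i\<in>set l. fact (count_list l i))"

lemma finite_partitions: "finite (partitions n)"
proof -
  have "length l \<le> sum_list l" if "\<forall>x\<in>set l. x > 0" for l :: "nat list"
    using that by (induction l) auto
  hence "partitions n \<subseteq> {l. set l \<subseteq> {..n} \<and> length l \<le> n}"
    by (auto simp: partitions_def is_partition_def dest: member_le_sum_list)
  thus ?thesis by (rule finite_subset) (simp add: finite_lists_length_le)
qed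

lemma finite_partitions_len: "finite (partitions_len n r)"
  by (simp add: partitions_len_def finite_partitions)

section \<open>Monomial and elementary symmetric functions\<close>

definition exponents :: "nat multiset \<Rightarrow> nat multiset" where
  "exponents M = image_mset (count M) (mset_set (set_mset M))"

lemma size_exponents: "sum_mset (exponents M) = size M"
  by (simp add: exponents_def size_multiset_overloaded_eq sum_unfold_sum_mset)

lemma exponents_perm:
  assumes "bij \<pi>"
  shows "exponents (image_mset \<pi> M) = exponents M"
proof -
  have inj: "inj \<pi>" using assms by (rule bij_is_inj)
  have "mset_set (\<pi> ` set_mset M) = image_mset \<pi> (mset_set (set_mset M))"
    using inj by (simp add: image_mset_mset_set inj_on_subset)
  thus ?thesis by (simp add: exponents_def count_image_mset_bij[OF assms] multiset.map_comp comp_def)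
qed

text \<open>\<open>m\<^sub>\<lambda>\<close> is the sum of all distinct monomials whose nonzero exponents are the parts of \<open>\<lambda>\<close>.\<close>

lift_definition mono_sym :: "nat list \<Rightarrow> 'a::comm_ring_1 symfun" is
  "\<lambda>l M. if exponents M = mset l then 1 else 0"
proof -
  fix l :: "nat list"
  have "size M = sum_list l" if "exponents M = mset l" for M
    using size_exponents[of M] that by (simp add: sum_mset_sum_list)
  thus "symmetric_series (\<lambda>M. if exponents M = mset l then 1 else 0 :: 'a)"
    by (intro symmetric_seriesI[of "sum_list l"]) (auto simp: exponents_perm)
qed

text \<open>\<open>e\<^sub>n\<close> is the sum of all squarefree monomials of degree \<open>n\<close>.\<close>

lift_definition elem_sym :: "nat \<Rightarrow> 'a::comm_ring_1 symfun" is
  "\<lambda>n M. if size M = n \<and> (\<forall>i. count M i \<le> 1) then 1 else 0"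
proof -
  fix n :: nat
  have "(\<forall>i. count (image_mset \<pi> M) i \<le> 1) \<longleftrightarrow> (\<forall>i. count M i \<le> 1)"
    if "bij \<pi>" for \<pi> :: "nat \<Rightarrow> nat" and M
    using count_image_mset_bij[OF that] that by (metis bij_pointE)
  thus "symmetric_series (\<lambda>M. if size M = n \<and> (\<forall>i. count M i \<le> 1) then 1 else 0 :: 'a)"
    by (intro symmetric_seriesI[of n]) auto
qed

definition p_sym :: "nat \<Rightarrow> nat \<Rightarrow> 'a::comm_ring_1 symfun" where
  "p_sym n r = (\<Sum>l\<in>partitions_len n r. mono_sym l)"

section \<open>The specialization and the associated polynomials\<close>

type_synonym Qq = "rat poly fract"

definition q :: Qq where
  "q = Fract [:0, 1:] 1"

definition is_specialization :: "(Qq symfun \<Rightarrow> Qq) \<Rightarrow> bool" where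
  "is_specialization \<phi> \<longleftrightarrow>
     algebra_hom \<phi> \<and> (\<forall>n. \<phi> (elem_sym n) = q ^ (n choose 2) / fact n)"

text \<open>
  \<open>J\<^sub>\<lambda>\<close> and \<open>J\<^sub>n\<^sup>(\<^sup>r\<^sup>)\<close> are the unique solutions in \<open>Q(q)\<close> of their defining equations, which are stated
  as lemmas \<open>J_part_eq\<close> and \<open>J_num_eq\<close> below.
  That they lie in \<open>\<int>[q]\<close> is a separate theorem and not built into the definitions.
\<close>

definition J_part :: "(Qq symfun \<Rightarrow> Qq) \<Rightarrow> nat list \<Rightarrow> Qq" where
  "J_part \<phi> l = \<phi> (mono_sym l) /
     ((1 - q) ^ (sum_list l - length l) *
      (q ^ n_stat l / (fact (sum_list l - 1) * of_nat (m_fact l))))"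

definition J_num :: "(Qq symfun \<Rightarrow> Qq) \<Rightarrow> nat \<Rightarrow> nat \<Rightarrow> Qq" where
  "J_num \<phi> n r = \<phi> (p_sym n r) /
     ((1 - q) ^ (n - r) * (q ^ (r choose 2) / (fact r * fact (n - r))))"

lemma q_nonzero: "q \<noteq> 0" "q \<noteq> 1"
  by (simp_all add: q_def Zero_fract_def One_fract_def eq_fract one_pCons)

lemma m_fact_nonzero: "m_fact l \<noteq> 0"
  by (simp add: m_fact_def)

lemma J_part_eq:
  "\<phi> (mono_sym l) =
     (1 - q) ^ (sum_list l - length l) *
     (q ^ n_stat l / (fact (sum_list l - 1) * of_nat (m_fact l))) * J_part \<phi> l"
  by (simp add: J_part_def q_nonzero m_fact_nonzero)

lemma J_num_eq:
  "\<phi> (p_sym n r) =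
     (1 - q) ^ (n - r) * (q ^ (r choose 2) / (fact r * fact (n - r))) * J_num \<phi> n r"
  by (simp add: J_num_def q_nonzero)

end

theory Submission
  imports Defs
begin

text \<open>All partitions of n with r parts share the factors (1-q)^(n-r) and (n-1)!, so summing
  the defining equations of their J's and cancelling (1-q)^(n-r) gives the first equation
  (\<open>J_part_sum\<close>).

  The second rests on p_{m+1}^(1) = sum over r of (1-q)^r p_m^(r), valid after specialization
  (\<open>specialization_power_sum_Suc\<close>). Before specialization, a Newton-type identity
  (\<open>elem_sym_p_sym\<close>) reads: the sum over k of (-1)^k e_k p_{m-k}^(r) is (-1)^(m-r)
  binom(m,r) e_m. The specialization satisfies (m+1) e_{m+1} = q^m e_m; expanding (-q)^m =
  ((1-q)-1)^m binomially shows that both sides of the claimed formula have the same convolution with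
  the (-1)^k e_k, and since e_0 = 1 they agree by induction. Inserting the first equation for every
  r then gives the second (\<open>J_num_1_sum\<close>).\<close>

section \<open>Monomial coefficients of p_n^(r)\<close>

lemma coeff_sym_sum: "coeff_sym (sum f A) M = (\<Sum>x\<in>A. coeff_sym (f x) M)"
  by (induction A rule: infinite_finite_induct) (simp_all add: zero_symfun.rep_eq plus_symfun.rep_eq)

lemma partitions_len_mset_iff:
  "l \<in> partitions_len n r \<and> exponents M = mset l \<longleftrightarrow>
     size M = n \<and> card (set_mset M) = r \<and> l = rev (sorted_list_of_multiset (exponents M))"
proof -
  define s where "s = sorted_list_of_multiset (exponents M)"
  have s: "mset s = exponents M" "sorted s"
    by (simp_all add: s_def sorted_sorted_list_of_multiset)
  have "length s = card (set_mset M)"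
    using s(1) by (metis exponents_def size_image_mset size_mset size_mset_set)
  moreover have "sum_list s = size M"
    using s(1) by (metis size_exponents sum_mset_sum_list)
  moreover have "\<forall>x\<in>set s. x > 0"
    by (auto simp: s_def exponents_def)
  moreover have "sorted_wrt (\<ge>) (rev s)"
    using s(2) by (simp add: sorted_wrt_rev)
  moreover have "l = rev s" if "sorted_wrt (\<ge>) l" "exponents M = mset l"
  proof -
    have "sorted (rev l)" using that(1) by (simp add: sorted_wrt_rev)
    with that(2) s have "rev l = s"
      by (metis mset_rev properties_for_sort sorted_sort_id)
    thus ?thesis by auto
  qed
  ultimately show ?thesis
    using s(1) unfolding partitions_len_def partitions_def is_partition_def s_def[symmetric]
    by (auto; (metis length_rev sum_list_rev)?)
qed

text \<open>Sorting the exponents of a monomial recovers the only partition to which it belongs, so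
  no monomial is counted twice.\<close>

lemma coeff_p_sym:
  "coeff_sym (p_sym n r) M = (if size M = n \<and> card (set_mset M) = r then 1 else 0)"
proof -
  have "coeff_sym (p_sym n r) M =
      (\<Sum>l\<in>partitions_len n r. if exponents M = mset l then 1 else (0 :: 'a))"
    by (simp add: p_sym_def coeff_sym_sum mono_sym.rep_eq)
  also have "\<dots> = of_nat (card {l \<in> partitions_len n r. exponents M = mset l})"
    by (simp add: sum.If_cases finite_partitions_len Int_def)
  also have "{l \<in> partitions_len n r. exponents M = mset l} =
      (if size M = n \<and> card (set_mset M) = r
       then {rev (sorted_list_of_multiset (exponents M))} else {})"
    using partitions_len_mset_iff[of _ n r M] by auto
  finally show ?thesis by auto
qed

lemma p_sym_eq_0:
  assumes "n < r"
  shows "p_sym n r = 0"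
proof -
  have "\<not> (size M = n \<and> card (set_mset M) = r)" for M :: "nat multiset"
    using assms size_mset_mono[of "mset_set (set_mset M)" M]
    by (metis mset_set_set_mset_msubset not_le size_mset_set)
  thus ?thesis
    by (auto simp: coeff_p_sym zero_symfun.rep_eq fun_eq_iff simp flip: coeff_sym_inject)
qed

section \<open>Newton-type identities between e_k and p_n^(r)\<close>

lemma mset_set_set_mset_squarefree:
  assumes "\<forall>i. count A i \<le> 1"
  shows "mset_set (set_mset A) = A"
proof (rule multiset_eqI)
  fix i
  show "count (mset_set (set_mset A)) i = count A i"
    using assms[rule_format, of i] by (cases "i \<in># A") (auto simp: not_in_iff le_Suc_eq count_mset_set' simp flip: count_greater_zero_iff)
qed

text \<open>This is the coefficient of M in the alternating sum of e_k p^(r): S is the squarefree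
  factor taken from e_k, and the cofactor must involve r variables. For squarefree M this forces |S|
  = |M| - r; otherwise a repeated variable gives a sign-reversing involution.\<close>

lemma signed_sum_squarefree_submultisets:
  "(\<Sum>S\<in>{S. S \<subseteq> set_mset M \<and> card (set_mset (M - mset_set S)) = r}. (-1) ^ card S) =
     (if \<forall>i. count M i \<le> 1 then (-1) ^ (size M - r) * of_nat (size M choose r) else 0 :: 'a::comm_ring_1)"
proof (cases "\<forall>i. count M i \<le> 1")
  case True
  define U where "U = set_mset M"
  have M: "M = mset_set U" using mset_set_set_mset_squarefree[OF True] by (simp add: U_def)
  have U: "finite U" "size M = card U" by (auto simp: U_def) (metis M U_def size_mset_set)
  have diff: "card (set_mset (M - mset_set S)) = card U - card S" if "S \<subseteq> U" for S
  proof -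
    have "finite S" using that U by (auto intro: finite_subset)
    moreover have "mset_set U - mset_set S = mset_set (U - S)"
      using that U by (simp add: mset_set_Diff)
    ultimately show ?thesis using U that by (simp add: M card_Diff_subset)
  qed
  show ?thesis
  proof (cases "r \<le> card U")
    case le: True
    have "{S. S \<subseteq> set_mset M \<and> card (set_mset (M - mset_set S)) = r} =
        {S. S \<subseteq> U \<and> card S = card U - r}"
      using diff le card_mono[OF U(1)] by (fastforce simp: U_def[symmetric])
    moreover have "(\<Sum>S\<in>{S. S \<subseteq> U \<and> card S = card U - r}. (-1) ^ card S :: 'a) =
        (\<Sum>S\<in>{S. S \<subseteq> U \<and> card S = card U - r}. (-1) ^ (card U - r))"
      by (rule sum.cong) auto
    ultimately show ?thesis
      using True U le by (simp add: n_subsets binomial_symmetric[OF le] mult.commute)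
  next
    case False
    \<comment> \<open>The cofactor has at most |U| < r variables; on the right the binomial
      vanishes, whatever the truncated exponent.\<close>
    hence empty: "{S. S \<subseteq> set_mset M \<and> card (set_mset (M - mset_set S)) = r} = {}"
      using diff by (auto simp: U_def[symmetric])
    show ?thesis unfolding empty using False U(2) by (simp add: binomial_eq_0)
  qed
next
  case False
  then obtain x where x: "count M x \<ge> 2" by (metis not_less_eq_eq numeral_2_eq_2 One_nat_def)
  \<comment> \<open>Toggling the membership of \<open>x\<close> in \<open>S\<close> does not affect the support of \<open>M - S\<close>.\<close>
  define T where "T = {S. S \<subseteq> set_mset M - {x} \<and> card (set_mset (M - mset_set S)) = r}"
  have finS: "finite S" if "S \<subseteq> set_mset M" for S
    using that by (rule finite_subset) simp
  have xM: "x \<in># M" using x by (metis count_eq_zero_iff not_numeral_le_zero)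
  have supp: "set_mset (M - mset_set (insert x S)) = set_mset (M - mset_set S)"
    if "S \<subseteq> set_mset M - {x}" for S
  proof -
    have "finite S" using that by (auto intro!: finS)
    hence "y \<in># M - mset_set (insert x S) \<longleftrightarrow> y \<in># M - mset_set S" for y
      using x xM by (cases "y = x") (auto simp: in_diff_count count_mset_set')
    thus ?thesis by blast
  qed
  have split: "{S. S \<subseteq> set_mset M \<and> card (set_mset (M - mset_set S)) = r} = T \<union> insert x ` T"
  proof (intro equalityI subsetI)
    fix S assume S: "S \<in> {S. S \<subseteq> set_mset M \<and> card (set_mset (M - mset_set S)) = r}"
    show "S \<in> T \<union> insert x ` T"
    proof (cases "x \<in> S")
      case True
      hence eq: "S = insert x (S - {x})" by auto
      have "S - {x} \<subseteq> set_mset M - {x}" using S by auto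
      hence "set_mset (M - mset_set S) = set_mset (M - mset_set (S - {x}))"
        using supp[of "S - {x}"] eq by metis
      hence "S - {x} \<in> T" using S by (auto simp: T_def)
      thus ?thesis using eq by blast
    next
      case False
      thus ?thesis using S by (auto simp: T_def)
    qed
  next
    fix S assume "S \<in> T \<union> insert x ` T"
    thus "S \<in> {S. S \<subseteq> set_mset M \<and> card (set_mset (M - mset_set S)) = r}"
      using supp xM by (auto simp: T_def)
  qed
  have "finite T" by (rule finite_subset[of _ "Pow (set_mset M)"]) (auto simp: T_def)
  moreover have "T \<inter> insert x ` T = {}" by (auto simp: T_def)
  moreover have "inj_on (insert x) T" by (auto simp: T_def inj_on_def)
  moreover have "card (insert x S) = Suc (card S)" if "S \<in> T" for S
  proof -
    have "finite S" "x \<notin> S" using that by (auto simp: T_def intro!: finS)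
    thus ?thesis by simp
  qed
  ultimately show ?thesis
    unfolding split if_not_P[OF False] by (simp add: sum.union_disjoint sum.reindex sum_negf)
qed

text \<open>
  In terms of generating functions this is the coefficient of \<open>t\<^sup>m u\<^sup>r\<close> in
  \<open>\<Prod>\<^sub>i (1 - x\<^sub>i t) (1 + u x\<^sub>i t / (1 - x\<^sub>i t)) = \<Prod>\<^sub>i (1 - (1 - u) x\<^sub>i t)\<close>; for \<open>r = 1\<close> these are Newton's
  identities.
\<close>

lemma elem_sym_p_sym:
  "(\<Sum>k\<le>m. scale_sym ((-1) ^ k) (elem_sym k * p_sym (m - k) r)) =
     (scale_sym ((-1) ^ (m - r) * of_nat (m choose r)) (elem_sym m) :: 'a::comm_ring_1 symfun)"
proof (subst coeff_sym_inject[symmetric], rule ext)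
  fix M :: "nat multiset"
  let ?sf = "\<lambda>A :: nat multiset. \<forall>i. count A i \<le> 1"
  let ?P = "\<lambda>A. ?sf A \<and> card (set_mset (M - A)) = r \<and> size M = m"
  \<comment> \<open>Only k = |A| contributes to a given A, so the sum over k collapses once the sums
    are swapped.\<close>
  have "coeff_sym (\<Sum>k\<le>m. scale_sym ((-1) ^ k) (elem_sym k * p_sym (m - k) r)) M =
      (\<Sum>k\<le>m. \<Sum>A | A \<subseteq># M. if k = size A then if ?P A then (-1) ^ size A else 0 else (0 :: 'a))"
    unfolding coeff_sym_sum scale_sym.rep_eq times_symfun.rep_eq series_times_def sum_distrib_left
  proof (intro sum.cong refl)
    fix k A assume k: "k \<in> {..m}" and A: "A \<in> {A. A \<subseteq># M}"
    have "size (M - A) = size M - size A" "size A \<le> size M"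
      using A by (auto simp: size_Diff_submset size_mset_mono)
    hence "size (M - A) = m - k \<longleftrightarrow> size M = m" if "size A = k"
      using k that by auto
    thus "(- 1) ^ k * (coeff_sym (elem_sym k) A * coeff_sym (p_sym (m - k) r) (M - A)) =
        (if k = size A then if ?P A then (-1) ^ size A else 0 else (0 :: 'a))"
      by (auto simp: elem_sym.rep_eq coeff_p_sym)
  qed
  also have "\<dots> = (\<Sum>A | A \<subseteq># M. if ?P A then (-1) ^ size A else 0)"
    by (subst sum.swap, rule sum.cong) (auto dest: size_mset_mono)
  also have "\<dots> = (\<Sum>A | A \<subseteq># M \<and> ?P A. (-1) ^ size A)"
    by (rule sum.mono_neutral_cong_right) (auto simp: finite_submultisets)
  \<comment> \<open>A squarefree monomial A is the same thing as its support S.\<close>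
  also have "\<dots> = (if size M = m then
      \<Sum>S\<in>{S. S \<subseteq> set_mset M \<and> card (set_mset (M - mset_set S)) = r}. (-1) ^ card S else 0)"
  proof (cases "size M = m")
    case True
    have fin: "finite S" if "S \<subseteq> set_mset M" for S using that by (rule finite_subset) simp
    have "(\<Sum>A | A \<subseteq># M \<and> ?P A. (-1) ^ size A :: 'a) =
      (\<Sum>S\<in>{S. S \<subseteq> set_mset M \<and> card (set_mset (M - mset_set S)) = r}. (-1) ^ card S)"
    proof (rule sum.reindex_bij_witness[of _ mset_set set_mset], goal_cases)
      case (1 A) thus ?case by (simp add: mset_set_set_mset_squarefree)
    next
      case (2 A) thus ?case by (auto simp: mset_set_set_mset_squarefree dest: mset_subset_eqD)
    next
      case (3 S) thus ?case by (simp add: fin)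
    next
      case (4 S)
      hence "mset_set S \<subseteq># M"
        using fin[of S] by (auto simp: subseteq_mset_def count_mset_set' Suc_le_eq)
      thus ?case using 4 True by (auto simp: count_mset_set')
    next
      case (5 A) thus ?case by (metis (lifting) mem_Collect_eq mset_set_set_mset_squarefree size_mset_set)
    qed
    thus ?thesis using True by simp
  qed auto
  also have "\<dots> = coeff_sym (scale_sym ((-1) ^ (m - r) * of_nat (m choose r)) (elem_sym m)) M"
    by (simp add: signed_sum_squarefree_submultisets scale_sym.rep_eq elem_sym.rep_eq)
  finally show "coeff_sym (\<Sum>k\<le>m. scale_sym ((-1) ^ k) (elem_sym k * p_sym (m - k) r)) M =
      coeff_sym (scale_sym ((-1) ^ (m - r) * of_nat (m choose r)) (elem_sym m) :: 'a symfun) M" .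
qed

section \<open>Power sums under the specialization\<close>

lemma algebra_hom_zero: "algebra_hom \<phi> \<Longrightarrow> \<phi> 0 = 0"
  unfolding algebra_hom_def by (metis add_cancel_left_left)

lemma algebra_hom_sum:
  assumes "algebra_hom \<phi>"
  shows "\<phi> (sum f A) = (\<Sum>x\<in>A. \<phi> (f x))"
  using algebra_hom_zero[OF assms] assms
  by (induction A rule: infinite_finite_induct) (simp_all add: algebra_hom_def)

context
  fixes \<phi> :: "Qq symfun \<Rightarrow> Qq"
  assumes spec: "is_specialization \<phi>"
begin

lemma specialization_hom: "algebra_hom \<phi>"
  using spec by (simp add: is_specialization_def)

lemma specialization_p_sym:
  "(\<Sum>k\<le>m. (-1) ^ k * (q ^ (k choose 2) / fact k) * \<phi> (p_sym (m - k) r)) =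
     (-1) ^ (m - r) * of_nat (m choose r) * (q ^ (m choose 2) / fact m)"
  using arg_cong[OF elem_sym_p_sym[of m r], of \<phi>] spec
  by (simp add: algebra_hom_sum[OF specialization_hom] is_specialization_def algebra_hom_def mult.assoc)

text \<open>
  For \<open>E(t) = \<Sum>\<^sub>n q\<^bsup>n(n-1)/2\<^esup> t\<^sup>n / n!\<close> one has \<open>E'(t) = E(q t)\<close>, so the two sides are the coefficients of
  \<open>E'(-t) / E(-t)\<close> and \<open>E(-q t) / E(-t)\<close>.
\<close>

lemma specialization_power_sum_Suc:
  "\<phi> (p_sym (Suc m) 1) = (\<Sum>r\<le>m. (1 - q) ^ r * \<phi> (p_sym m r))"
proof (induction m rule: less_induct)
  case (less m)
  define W where "W n = (\<Sum>r\<le>n. (1 - q) ^ r * \<phi> (p_sym n r))" for n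
  define c where "c k = (-1) ^ k * (q ^ (k choose 2) / fact k)" for k
  \<comment> \<open>Terms with r > n vanish; the common range r \<le> m allows the double sum to be
    swapped below.\<close>
  have W: "W n = (\<Sum>r\<le>m. (1 - q) ^ r * \<phi> (p_sym n r))" if "n \<le> m" for n
    unfolding W_def using that by (intro sum.mono_neutral_left) (auto simp: p_sym_eq_0 algebra_hom_zero[OF specialization_hom])
  have ch: "Suc m choose 2 = (m choose 2) + m"
    by (simp add: numeral_2_eq_2)
  \<comment> \<open>The extra term k = m+1 contains p_0^(1) = 0.\<close>
  have "(\<Sum>k\<le>m. c k * \<phi> (p_sym (Suc m - k) 1)) =
      (\<Sum>k\<le>Suc m. c k * \<phi> (p_sym (Suc m - k) 1))"
    by (simp add: p_sym_eq_0 algebra_hom_zero[OF specialization_hom])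
  also have "\<dots> = (-1) ^ m * of_nat (Suc m) * (q ^ (Suc m choose 2) / fact (Suc m))"
    unfolding c_def specialization_p_sym by simp
  \<comment> \<open>Coefficient form of E'(t) = E(q t).\<close>
  also have "\<dots> = (-1) ^ m * (q ^ m * (q ^ (m choose 2) / fact m))"
    unfolding ch fact_Suc power_add by (simp del: of_nat_Suc)
  \<comment> \<open>Writing -q as (1-q) + (-1) makes the binomial terms match the right-hand side of
    \<open>specialization_p_sym\<close>.\<close>
  also have "\<dots> = ((1 - q) + (-1)) ^ m * (q ^ (m choose 2) / fact m)"
    by (simp add: power_minus[of q])
  also have "\<dots> = (\<Sum>r\<le>m. (1 - q) ^ r *
      ((-1) ^ (m - r) * of_nat (m choose r) * (q ^ (m choose 2) / fact m)))"
    by (subst binomial_ring) (simp add: sum_distrib_left sum_divide_distrib mult_ac)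
  also have "\<dots> = (\<Sum>r\<le>m. (1 - q) ^ r * (\<Sum>k\<le>m. c k * \<phi> (p_sym (m - k) r)))"
    unfolding c_def specialization_p_sym ..
  also have "\<dots> = (\<Sum>k\<le>m. c k * W (m - k))"
    by (simp add: W sum_distrib_left mult_ac) (rule sum.swap)
  finally have "(\<Sum>k\<le>m. c k * \<phi> (p_sym (Suc m - k) 1)) = (\<Sum>k\<le>m. c k * W (m - k))" .
  \<comment> \<open>Terms with k \<ge> 1 agree by induction; as c 0 = 1, the k = 0 terms are the
    claim.\<close>
  moreover have "(\<Sum>k\<in>{1..m}. c k * \<phi> (p_sym (Suc m - k) 1)) = (\<Sum>k\<in>{1..m}. c k * W (m - k))"
    using less.IH by (intro sum.cong) (auto simp: W_def Suc_diff_le)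
  moreover have "{..m} = insert 0 {1..m}" by auto
  ultimately show ?case by (simp add: c_def W_def numeral_2_eq_2)
qed

section \<open>The two equations for the polynomials J\<close>

lemma J_part_sum:
  assumes "1 \<le> r" "r \<le> n"
  shows "fact (n - 1) / (fact r * fact (n - r)) * q ^ (r choose 2) * J_num \<phi> n r =
    (\<Sum>l\<in>partitions_len n r. J_part \<phi> l / of_nat (m_fact l) * q ^ n_stat l)"
    (is "?L = ?R")
proof -
  have "(1 - q) ^ (n - r) * ?L = fact (n - 1) * \<phi> (p_sym n r)"
    by (simp add: J_num_eq)
  also have "\<dots> = (\<Sum>l\<in>partitions_len n r. fact (n - 1) * \<phi> (mono_sym l))"
    by (simp add: p_sym_def algebra_hom_sum[OF specialization_hom] sum_distrib_left)
  also have "\<dots> = (\<Sum>l\<in>partitions_len n r.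
      (1 - q) ^ (n - r) * (J_part \<phi> l / of_nat (m_fact l) * q ^ n_stat l))"
    by (rule sum.cong) (auto simp: partitions_len_def partitions_def J_part_eq)
  also have "\<dots> = (1 - q) ^ (n - r) * ?R"
    by (simp add: sum_distrib_left)
  finally show ?thesis
    using q_nonzero by (simp only: mult_cancel_left power_eq_0_iff right_minus_eq) auto
qed

lemma J_num_1_sum:
  assumes "1 \<le> m"
  shows "J_num \<phi> (Suc m) 1 =
    of_nat m * (\<Sum>l\<in>partitions m. J_part \<phi> l / of_nat (m_fact l) * q ^ n_stat l)"
    (is "_ = of_nat m * sum ?f _")
proof -
  have "length l \<le> sum_list l" if "\<forall>x\<in>set l. x > 0" for l :: "nat list"
    using that by (induction l) auto
  hence "partitions m = (\<Union>r\<in>{1..m}. partitions_len m r)"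
    using assms by (auto simp: partitions_len_def partitions_def is_partition_def Suc_le_eq)
  moreover have "sum ?f (\<Union>r\<in>{1..m}. partitions_len m r) =
      (\<Sum>r\<in>{1..m}. sum ?f (partitions_len m r))"
    by (rule sum.UNION_disjoint) (auto simp: finite_partitions_len, auto simp: partitions_len_def)
  ultimately have "sum ?f (partitions m) = (\<Sum>r\<in>{1..m}. sum ?f (partitions_len m r))"
    by simp
  also have "\<dots> = (\<Sum>r\<in>{1..m}.
      fact (m - 1) / (fact r * fact (m - r)) * q ^ (r choose 2) * J_num \<phi> m r)"
    using J_part_sum by (intro sum.cong) auto
  finally have "(1 - q) ^ m * (of_nat m * sum ?f (partitions m)) =
      (\<Sum>r\<in>{1..m}. (1 - q) ^ m * (of_nat m *
        (fact (m - 1) / (fact r * fact (m - r)) * q ^ (r choose 2) * J_num \<phi> m r)))"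
    by (simp add: sum_distrib_left)
  \<comment> \<open>Of the m factors 1-q, m-r turn J_m^(r) back into p_m^(r), and r remain as the
    weight in \<open>specialization_power_sum_Suc\<close>.\<close>
  also have "\<dots> = (\<Sum>r\<in>{1..m}. fact m * ((1 - q) ^ r * \<phi> (p_sym m r)))"
  proof (rule sum.cong)
    fix r assume r: "r \<in> {1..m}"
    have "(1 - q) ^ m = (1 - q) ^ r * (1 - q) ^ (m - r)"
      using r by (simp flip: power_add)
    moreover have "fact m = (of_nat m * fact (m - 1) :: Qq)"
      using assms by (simp add: fact_reduce)
    ultimately show "(1 - q) ^ m * (of_nat m *
        (fact (m - 1) / (fact r * fact (m - r)) * q ^ (r choose 2) * J_num \<phi> m r)) =
        fact m * ((1 - q) ^ r * \<phi> (p_sym m r))"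
      by (simp add: J_num_eq)
  qed simp
  also have "\<dots> = fact m * (\<Sum>r\<le>m. (1 - q) ^ r * \<phi> (p_sym m r))"
  \<comment> \<open>The missing term r = 0 is zero, since a positive m has no partition without
    parts.\<close>
  proof -
    have "p_sym m 0 = (0 :: Qq symfun)"
      using assms by (auto simp: p_sym_def partitions_len_def partitions_def intro!: sum.neutral)
    moreover have "{..m} = insert 0 {1..m}" by auto
    ultimately show ?thesis by (simp add: sum_distrib_left algebra_hom_zero[OF specialization_hom])
  qed
  also have "\<dots> = (1 - q) ^ m * J_num \<phi> (Suc m) 1"
    unfolding specialization_power_sum_Suc[symmetric] by (simp add: J_num_eq numeral_2_eq_2)
  finally show ?thesis using q_nonzero by simp
qed

end

theorem corollary3p6:
  fixes \<phi> :: "Qq symfun \<Rightarrow> Qq"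
  assumes "is_specialization \<phi>"
  shows "(\<forall>n r. 1 \<le> r \<and> r \<le> n \<longrightarrow>
      fact (n - 1) / (fact r * fact (n - r)) * q ^ (r choose 2) * J_num \<phi> n r =
        (\<Sum>l\<in>partitions_len n r. J_part \<phi> l / of_nat (m_fact l) * q ^ n_stat l) \<and>
      (0 :: rat) < fact (n - 1) / (fact r * fact (n - r)) \<and>
      (\<forall>l\<in>partitions_len n r. (0 :: rat) < 1 / of_nat (m_fact l)))
    \<and> (\<forall>n\<ge>2.
      J_num \<phi> n 1 =
        of_nat (n - 1) * (\<Sum>l\<in>partitions (n - 1). J_part \<phi> l / of_nat (m_fact l) * q ^ n_stat l) \<and>
      (\<forall>l\<in>partitions (n - 1). (0 :: rat) < of_nat (n - 1) / of_nat (m_fact l)))"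
proof -
  \<comment> \<open>All the positivity claims reduce to this, with n - 1 > 0 for n \<ge> 2.\<close>
  have m_fact_pos: "0 < m_fact l" for l
    using m_fact_nonzero[of l] by simp
  have "J_num \<phi> n 1 = of_nat (n - 1) *
      (\<Sum>l\<in>partitions (n - 1). J_part \<phi> l / of_nat (m_fact l) * q ^ n_stat l)" if "n \<ge> 2" for n
    using J_num_1_sum[OF assms, of "n - 1"] that by (cases n) auto
  thus ?thesis
    using J_part_sum[OF assms] m_fact_pos by (auto simp del: One_nat_def intro!: divide_pos_pos)
qed

end
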